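(* Let $\boldsymbol{Z}_1, \boldsymbol{Z}_2 \in \mathbb{R}^{n\times d}$ be two congruent embedding matrices, i.e. $\Vert (\boldsymbol{Z}_1)_{i:} - (\boldsymbol{Z}_1)_{j:}\Vert_2 = \Vert (\boldsymbol{Z}_2)_{i:} - (\boldsymbol{Z}_2)_{j:}\Vert_2$ for all $i,j\in\{1,\dots,n\}$. Then for any multilayer perceptron with bias $\mathrm{MLP}_M$ (taking inputs in $\mathbb{R}^{n\times d}$), there exists another multilayer perceptron with bias $\mathrm{MLP}_N$ such that $\mathrm{MLP}_M(\boldsymbol{Z}_1) = \mathrm{MLP}_N(\boldsymbol{Z}_2)$.
   Context: For a matrix $\boldsymbol{X}$, $\boldsymbol{X}_{i:}$ denotes its $i$-th row. An MLP with bias, with $L\ge 1$ layers, is a map $\boldsymbol{X}^{(0)} \mapsto \boldsymbol{X}^{(L)}$ obtained by composing layers of the form $\boldsymbol{X}^{(k+1)} = \sigma\left(\boldsymbol{X}^{(k)}\boldsymbol{W}^{(k)} + \boldsymbol{1}(\boldsymbol{b}^{(k)})^\top\right)$, $k=0,\dots,L-1$, where $\boldsymbol{X}^{(k)}\in\mathbb{R}^{n\times d_k}$ (with $d_0=d$), $\boldsymbol{W}^{(k)}\in\mathbb{R}^{d_k\times d_{k+1}}$ is a real weight matrix, $\boldsymbol{b}^{(k)}\in\mathbb{R}^{d_{k+1}}$ is a real bias vector, $\boldsymbol{1}\in\mathbb{R}^n$ is the all-ones vector, and $\sigma$ is the activation function, applied elementwise (the same $\sigma$ for $\mathrm{MLP}_M$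 and $\mathrm{MLP}_N$). Linear layers are the special case in which $\sigma$ is the identity. *)

theory Defs
  imports "Jordan_Normal_Form.Matrix" "HOL-Analysis.L2_Norm"
begin

definition vec_norm2 :: "real vec \<Rightarrow> real" where
  "vec_norm2 v = L2_set (($) v) {0..<dim_vec v}"

text \<open>Rows are indexed from 0. The definition is meant for matrices of the same dimensions.\<close>

definition congruent_mats :: "real mat \<Rightarrow> real mat \<Rightarrow> bool" where
  "congruent_mats Z1 Z2 \<longleftrightarrow>
     (\<forall>i<dim_row Z1. \<forall>j<dim_row Z1.
        vec_norm2 (row Z1 i - row Z1 j) = vec_norm2 (row Z2 i - row Z2 j))"

text \<open>A layer is a weight matrix together with a bias vector; the activation function is kept
  separate, as it is shared by all layers.\<close>

type_synonym layer = "real mat \<times> real vec"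

fun layers_from :: "nat \<Rightarrow> layer list \<Rightarrow> bool" where
  "layers_from d [] \<longleftrightarrow> True"
| "layers_from d ((W, b) # ls) \<longleftrightarrow>
     (\<exists>d'>0. W \<in> carrier_mat d d' \<and> b \<in> carrier_vec d' \<and> layers_from d' ls)"

definition is_mlp :: "nat \<Rightarrow> layer list \<Rightarrow> bool" where
  "is_mlp d ls \<longleftrightarrow> ls \<noteq> [] \<and> layers_from d ls"

definition ones_col :: "nat \<Rightarrow> real mat" where
  "ones_col n = transpose_mat (mat_of_row (vec n (\<lambda>_. 1)))"

fun apply_layer :: "(real \<Rightarrow> real) \<Rightarrow> layer \<Rightarrow> real mat \<Rightarrow> real mat" where
  "apply_layer \<sigma> (W, b) X = map_mat \<sigma> (X * W + ones_col (dim_row X) * mat_of_row b)"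

definition mlp :: "(real \<Rightarrow> real) \<Rightarrow> layer list \<Rightarrow> real mat \<Rightarrow> real mat" where
  "mlp \<sigma> ls X = fold (apply_layer \<sigma>) ls X"

end

(*
  Taking row 0 as origin, polarization shows that the rows of Z1 and of Z2 have the same Gram
  matrix. Hence the rows of Z1 satisfy every linear relation that the rows of Z2 satisfy, so some
  affine map sends the rows of Z2 to those of Z1. Orthogonality of its linear part is irrelevant:
  the map is simply absorbed into the weights and the bias of the first layer.
*)
theory Submission
  imports Defs
begin

text \<open>Gram-Schmidt by induction on \<open>n\<close>, without normalization and for possibly
  dependent vectors: the residuals of \<open>x\<close> and of \<open>v n\<close> over the earlier
  vectors come from the induction hypothesis, which is why \<open>x\<close> is generalized, and the
  first is then made orthogonal to the second.\<close>

lemma orthogonal_residual_exists: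
  fixes v :: "nat \<Rightarrow> nat \<Rightarrow> real"
  shows "\<exists>c. \<forall>i<n. (\<Sum>k<d. (x k - (\<Sum>j<n. c j * v j k)) * v i k) = 0"
proof (induction n arbitrary: x)
  case 0
  then show ?case by simp
next
  case (Suc n)
  obtain a where a: "\<And>i. i < n \<Longrightarrow> (\<Sum>k<d. (x k - (\<Sum>j<n. a j * v j k)) * v i k) = 0"
    using Suc[of x] by blast
  obtain b where b: "\<And>i. i < n \<Longrightarrow> (\<Sum>k<d. (v n k - (\<Sum>j<n. b j * v j k)) * v i k) = 0"
    using Suc[of "v n"] by blast
  define y where "y k = x k - (\<Sum>j<n. a j * v j k)" for k
  define w where "w k = v n k - (\<Sum>j<n. b j * v j k)" for k
  \<comment> \<open>Coefficient of the projection of \<open>y\<close> onto \<open>w\<close>. If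
    \<open>w\<close> vanishes on the range, the division by zero gives \<open>t = 0\<close>, and the
    identity \<open>t\<close> below still holds since both sides are 0.\<close>
  define t where "t = (\<Sum>k<d. y k * w k) / (\<Sum>k<d. w k * w k)"
  \<comment> \<open>Coefficients obtained by expanding \<open>y - t * w\<close> in terms of
    \<open>x\<close> and the \<open>v j\<close>.\<close>
  define c where "c j = (if j = n then t else a j - t * b j)" for j
  have residual: "x k - (\<Sum>j<Suc n. c j * v j k) = y k - t * w k" for k
    by (simp add: c_def y_def w_def algebra_simps sum_subtractf sum_distrib_left)
  have t: "(\<Sum>k<d. y k * w k) = t * (\<Sum>k<d. w k * w k)"
  proof (cases "(\<Sum>k<d. w k * w k) = 0")
    case True
    then have "\<forall>k<d. w k = 0" by (auto simp: sum_nonneg_eq_0_iff)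
    then show ?thesis by simp
  qed (simp add: t_def)
  have perp_v: "(\<Sum>k<d. (y k - t * w k) * v i k) = 0" if "i < n" for i
    using a[OF that] b[OF that] unfolding y_def[symmetric] w_def[symmetric]
    by (simp add: left_diff_distrib sum_subtractf mult.assoc flip: sum_distrib_left)
  have perp_w: "(\<Sum>k<d. (y k - t * w k) * w k) = 0"
    using t by (simp add: left_diff_distrib sum_subtractf mult.assoc flip: sum_distrib_left)
  \<comment> \<open>Since \<open>v n\<close> is \<open>w\<close> plus a combination of earlier
    vectors, orthogonality to these and to \<open>w\<close> gives orthogonality to
    \<open>v n\<close>.\<close>
  have "(\<Sum>k<d. (y k - t * w k) * v n k)
      = (\<Sum>k<d. (y k - t * w k) * w k) + (\<Sum>j<n. b j * (\<Sum>k<d. (y k - t * w k) * v j k))"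
  proof -
    have "(\<Sum>j<n. b j * (\<Sum>k<d. (y k - t * w k) * v j k))
        = (\<Sum>k<d. (y k - t * w k) * (\<Sum>j<n. b j * v j k))"
      unfolding sum_distrib_left by (subst sum.swap) (simp add: mult_ac)
    then show ?thesis
      by (simp add: w_def flip: sum.distrib distrib_left)
  qed
  then have "(\<Sum>k<d. (y k - t * w k) * v i k) = 0" if "i < Suc n" for i
    using perp_v perp_w that by (cases "i = n") auto
  then show ?case
    by (intro exI[of _ c] allI impI) (simp only: residual)
qed

text \<open>The squared norm of a combination is a quadratic form in the Gram matrix. Families with
  equal Gram matrices therefore have the same vanishing combinations.\<close>

lemma sum_squares_combination:
  fixes e :: "nat \<Rightarrow> real"
  shows "(\<Sum>k<d. (\<Sum>i\<le>n. e i * v i k) * (\<Sum>i\<le>n. e i * v i k))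
    = (\<Sum>i\<le>n. \<Sum>j\<le>n. e i * e j * (\<Sum>k<d. v i k * v j k))"
proof -
  have "(\<Sum>k<d. (\<Sum>i\<le>n. e i * v i k) * (\<Sum>i\<le>n. e i * v i k))
      = (\<Sum>k<d. \<Sum>i\<le>n. \<Sum>j\<le>n. e i * e j * (v i k * v j k))"
    by (simp add: sum_product mult_ac)
  also have "\<dots> = (\<Sum>i\<le>n. \<Sum>k<d. \<Sum>j\<le>n. e i * e j * (v i k * v j k))"
    by (rule sum.swap)
  also have "\<dots> = (\<Sum>i\<le>n. \<Sum>j\<le>n. \<Sum>k<d. e i * e j * (v i k * v j k))"
    by (intro sum.cong refl) (rule sum.swap)
  finally show ?thesis by (simp add: sum_distrib_left)
qed

text \<open>Induction on \<open>n\<close>: a map \<open>Q\<close> that is right on the first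
  \<open>n\<close> vectors is corrected by a rank-one term that kills those vectors and repairs the
  image of \<open>v n\<close>.\<close>

lemma linear_map_of_equal_gram:
  fixes u v :: "nat \<Rightarrow> nat \<Rightarrow> real"
  assumes "\<And>i j. i < n \<Longrightarrow> j < n \<Longrightarrow> (\<Sum>k<d'. u i k * u j k) = (\<Sum>k<d. v i k * v j k)"
  shows "\<exists>Q. \<forall>i<n. \<forall>k<d'. u i k = (\<Sum>l<d. v i l * Q l k)"
  using assms
proof (induction n)
  case 0
  then show ?case by simp
next
  case (Suc n)
  have "\<exists>Q. \<forall>i<n. \<forall>k<d'. u i k = (\<Sum>l<d. v i l * Q l k)"
    by (rule Suc.IH) (simp add: Suc.prems)
  then obtain Q where Q: "\<And>i k. i < n \<Longrightarrow> k < d' \<Longrightarrow> u i k = (\<Sum>l<d. v i l * Q l k)"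
    by (elim exE) blast
  obtain c where c: "\<And>i. i < n \<Longrightarrow> (\<Sum>k<d. (v n k - (\<Sum>j<n. c j * v j k)) * v i k) = 0"
    using orthogonal_residual_exists by blast
  \<comment> \<open>\<open>w\<close> is the part of \<open>v n\<close> orthogonal to the earlier
    vectors, \<open>r\<close> the error of \<open>Q\<close> at \<open>v n\<close>, and
    \<open>s\<close> the squared norm of \<open>w\<close>.\<close>
  define w where "w k = v n k - (\<Sum>j<n. c j * v j k)" for k
  define r where "r k = u n k - (\<Sum>l<d. v n l * Q l k)" for k
  define s where "s = (\<Sum>l<d. w l * w l)"
  have w_perp: "(\<Sum>l<d. v i l * w l) = 0" if "i < n" for i
    using c[OF that] by (simp add: w_def mult.commute)
  have "(\<Sum>l<d. v n l * w l) = s + (\<Sum>j<n. c j * (\<Sum>l<d. v j l * w l))"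
  proof -
    have "(\<Sum>j<n. c j * (\<Sum>l<d. v j l * w l)) = (\<Sum>l<d. (\<Sum>j<n. c j * v j l) * w l)"
      unfolding sum_distrib_left sum_distrib_right by (subst sum.swap) (simp add: mult_ac)
    moreover have "v n l = w l + (\<Sum>j<n. c j * v j l)" for l
      by (simp add: w_def)
    ultimately show ?thesis
      by (simp add: s_def distrib_right sum.distrib)
  qed
  then have v_w: "(\<Sum>l<d. v n l * w l) = s"
    using w_perp by simp
  \<comment> \<open>Degenerate case: \<open>v n\<close> is a combination of the earlier vectors,
    equality of the Gram matrices forces the same combination for \<open>u n\<close>, and by
    linearity \<open>Q\<close> is already right at \<open>v n\<close>.\<close>
  have r_eq_0: "r k = 0" if s0: "s = 0" and k: "k < d'" for k
  proof -
    \<comment> \<open>Writes the residual as one combination over all indices up to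
      \<open>n\<close>, the form that \<open>sum_squares_combination\<close> handles.\<close>
    define e where "e j = (if j = n then 1 else - c j)" for j
    have residual: "(\<Sum>j\<le>n. e j * f j) = f n - (\<Sum>j<n. c j * f j)" for f :: "nat \<Rightarrow> real"
      by (simp add: e_def lessThan_Suc_atMost[symmetric] sum_negf)
    have "(\<Sum>k<d'. (\<Sum>i\<le>n. e i * u i k) * (\<Sum>i\<le>n. e i * u i k))
        = (\<Sum>k<d. (\<Sum>i\<le>n. e i * v i k) * (\<Sum>i\<le>n. e i * v i k))"
      unfolding sum_squares_combination using Suc.prems by simp
    also have "\<dots> = 0"
      using s0 by (simp add: residual w_def s_def)
    finally have "(\<Sum>i\<le>n. e i * u i k) = 0"
      using k by (subst (asm) sum_nonneg_eq_0_iff) auto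
    then have u: "u n k = (\<Sum>j<n. c j * u j k)"
      by (simp add: residual)
    have "\<forall>l<d. w l = 0"
      using s0 by (auto simp: s_def sum_nonneg_eq_0_iff)
    then have "(\<Sum>l<d. v n l * Q l k) = (\<Sum>l<d. (\<Sum>j<n. c j * v j l) * Q l k)"
      by (simp add: w_def)
    also have "\<dots> = (\<Sum>j<n. c j * (\<Sum>l<d. v j l * Q l k))"
      unfolding sum_distrib_left sum_distrib_right by (subst sum.swap) (simp add: mult_ac)
    also have "\<dots> = (\<Sum>j<n. c j * u j k)"
      using Q k by simp
    finally show ?thesis
      by (simp add: r_def u)
  qed
  \<comment> \<open>The correction adds \<open>r k / s\<close> times the inner product of
    \<open>v i\<close> with \<open>w\<close>: this is 0 for \<open>i < n\<close> and
    \<open>r k\<close> for \<open>i = n\<close>. If \<open>s = 0\<close>, both the quotient and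
    \<open>r k\<close> are 0.\<close>
  have "u i k = (\<Sum>l<d. v i l * (Q l k + w l * (r k / s)))" if "i < Suc n" "k < d'" for i k
  proof -
    have "(\<Sum>l<d. v i l * (Q l k + w l * (r k / s)))
        = (\<Sum>l<d. v i l * Q l k) + (\<Sum>l<d. v i l * w l) * (r k / s)"
      unfolding sum_distrib_right by (simp add: distrib_left sum.distrib mult.assoc)
    also have "\<dots> = u i k"
    proof (cases "i = n")
      case True
      then show ?thesis
        using v_w r_eq_0[of k] that by (cases "s = 0") (auto simp: r_def)
    next
      case False
      then show ?thesis using that w_perp Q by simp
    qed
    finally show ?thesis by simp
  qed
  then show ?case
    by (intro exI[of _ "\<lambda>l k. Q l k + w l * (r k / s)"]) simp
qed

lemma vec_norm2_row_diff:
  assumes "Z \<in> carrier_mat n d" "i < n" "j < n"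
  shows "vec_norm2 (row Z i - row Z j) = sqrt (\<Sum>k<d. (Z $$ (i, k) - Z $$ (j, k))\<^sup>2)"
  using assms by (simp add: vec_norm2_def L2_set_def lessThan_atLeast0)

text \<open>Polarization: an inner product is determined by the squared norms of the two vectors and
  of their difference.\<close>

lemma inner_eq_of_dist_eq:
  fixes a b a' b' :: "nat \<Rightarrow> real"
  assumes "(\<Sum>k\<in>A. (a k)\<^sup>2) = (\<Sum>k\<in>A. (a' k)\<^sup>2)" "(\<Sum>k\<in>A. (b k)\<^sup>2) = (\<Sum>k\<in>A. (b' k)\<^sup>2)"
    and "(\<Sum>k\<in>A. (a k - b k)\<^sup>2) = (\<Sum>k\<in>A. (a' k - b' k)\<^sup>2)"
  shows "(\<Sum>k\<in>A. a k * b k) = (\<Sum>k\<in>A. a' k * b' k)"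
proof -
  have polarization: "(\<Sum>k\<in>A. (f k - g k)\<^sup>2)
      = (\<Sum>k\<in>A. (f k)\<^sup>2) + (\<Sum>k\<in>A. (g k)\<^sup>2) - 2 * (\<Sum>k\<in>A. f k * g k)"
    for f g :: "nat \<Rightarrow> real"
    by (simp add: power2_diff sum.distrib sum_subtractf sum_distrib_left mult.assoc)
  show ?thesis
    using assms unfolding polarization by simp
qed

lemma ones_col_carrier [simp]: "ones_col n \<in> carrier_mat n 1"
  by (simp add: ones_col_def mat_of_row_def)

lemma index_ones_col_mult_mat_of_row:
  assumes "i < n" "k < dim_vec b"
  shows "(ones_col n * mat_of_row b) $$ (i, k) = b $ k"
  using assms by (simp add: ones_col_def mat_of_row_def scalar_prod_def)

text \<open>The linear part comes from \<open>linear_map_of_equal_gram\<close> applied to the rows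
  taken relative to row 0; the translation then matches the two origins.\<close>

lemma congruent_mats_affine:
  assumes Z1: "Z1 \<in> carrier_mat n d" and Z2: "Z2 \<in> carrier_mat n d"
    and cong: "congruent_mats Z1 Z2"
  obtains Q c where "Q \<in> carrier_mat d d" "c \<in> carrier_vec d"
    "Z1 = Z2 * Q + ones_col n * mat_of_row c"
proof -
  define u where "u i k = Z1 $$ (i, k) - Z1 $$ (0, k)" for i k
  define v where "v i k = Z2 $$ (i, k) - Z2 $$ (0, k)" for i k
  have dist: "(\<Sum>k<d. (Z1 $$ (i, k) - Z1 $$ (j, k))\<^sup>2) = (\<Sum>k<d. (Z2 $$ (i, k) - Z2 $$ (j, k))\<^sup>2)"
    if "i < n" "j < n" for i j
    using cong that Z1 by (simp add: congruent_mats_def vec_norm2_row_diff[OF Z1]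
        vec_norm2_row_diff[OF Z2])
  \<comment> \<open>Norms of \<open>u i\<close> and \<open>v i\<close> are distances to row 0, which
    exists because \<open>i < n\<close>; in \<open>u i - u j\<close> and \<open>v i - v j\<close>
    row 0 cancels.\<close>
  have gram: "(\<Sum>k<d. u i k * u j k) = (\<Sum>k<d. v i k * v j k)"
    if "i < n" "j < n" for i j
  proof (rule inner_eq_of_dist_eq)
    show "(\<Sum>k<d. (u i k)\<^sup>2) = (\<Sum>k<d. (v i k)\<^sup>2)" "(\<Sum>k<d. (u j k)\<^sup>2) = (\<Sum>k<d. (v j k)\<^sup>2)"
      using dist[of _ 0] that by (simp_all add: u_def v_def)
    show "(\<Sum>k<d. (u i k - u j k)\<^sup>2) = (\<Sum>k<d. (v i k - v j k)\<^sup>2)"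
      using dist that by (simp add: u_def v_def)
  qed
  obtain q where q: "\<forall>i<n. \<forall>k<d. u i k = (\<Sum>l<d. v i l * q l k)"
  proof -
    have "\<exists>Q. \<forall>i<n. \<forall>k<d. u i k = (\<Sum>l<d. v i l * Q l k)"
      by (rule linear_map_of_equal_gram) (rule gram)
    then show thesis
      using that by (elim exE)
  qed
  define Q where "Q = mat d d (\<lambda>(l, k). q l k)"
  \<comment> \<open>The translation forced by sending row 0 of \<open>Z2\<close> to row 0 of
    \<open>Z1\<close>. For \<open>n = 0\<close> its entries are unspecified, but there are no rows
    to compare.\<close>
  define c where "c = vec d (\<lambda>k. Z1 $$ (0, k) - (\<Sum>l<d. Z2 $$ (0, l) * q l k))"
  show ?thesis
  proof
    show Q: "Q \<in> carrier_mat d d" and c: "c \<in> carrier_vec d"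
      by (simp_all add: Q_def c_def)
    show "Z1 = Z2 * Q + ones_col n * mat_of_row c"
    proof (rule eq_matI)
      fix i k assume "i < dim_row (Z2 * Q + ones_col n * mat_of_row c)"
        "k < dim_col (Z2 * Q + ones_col n * mat_of_row c)"
      then have ik: "i < n" "k < d"
        using c ones_col_carrier[of n] by auto
      have "(Z2 * Q) $$ (i, k) = (\<Sum>l<d. Z2 $$ (i, l) * q l k)"
        using ik Z2 by (simp add: Q_def scalar_prod_def lessThan_atLeast0)
      moreover have "(ones_col n * mat_of_row c) $$ (i, k)
          = Z1 $$ (0, k) - (\<Sum>l<d. Z2 $$ (0, l) * q l k)"
        using ik by (simp add: index_ones_col_mult_mat_of_row c_def)
      moreover have "Z1 $$ (i, k) - Z1 $$ (0, k)
          = (\<Sum>l<d. Z2 $$ (i, l) * q l k) - (\<Sum>l<d. Z2 $$ (0, l) * q l k)"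
        using q ik by (simp add: u_def v_def left_diff_distrib sum_subtractf)
      ultimately show "Z1 $$ (i, k) = (Z2 * Q + ones_col n * mat_of_row c) $$ (i, k)"
        using ik c ones_col_carrier[of n] by simp
    qed (use Z1 c ones_col_carrier[of n] in auto)
  qed
qed

theorem theorem4p1:
  fixes n d :: nat and Z1 Z2 :: "real mat" and \<sigma> :: "real \<Rightarrow> real" and M :: "layer list"
  assumes "Z1 \<in> carrier_mat n d" and "Z2 \<in> carrier_mat n d"
    and "congruent_mats Z1 Z2"
    and "is_mlp d M"
  shows "\<exists>N. is_mlp d N \<and> mlp \<sigma> M Z1 = mlp \<sigma> N Z2"
proof -
  obtain W b ls d' where M: "M = (W, b) # ls" and d': "d' > 0"
    and W: "W \<in> carrier_mat d d'" and b: "b \<in> carrier_vec d'" and ls: "layers_from d' ls"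
    using assms(4) by (cases M) (auto simp: is_mlp_def)
  obtain Q c where Q: "Q \<in> carrier_mat d d" and c: "c \<in> carrier_vec d"
    and Z1: "Z1 = Z2 * Q + ones_col n * mat_of_row c"
    using congruent_mats_affine[OF assms(1-3)] by blast
  \<comment> \<open>The new bias as a one-row matrix: the first layer acts on the translation
    \<open>c\<close> through \<open>W\<close>, and the old bias is added. \<open>row B 0\<close>
    turns it back into a vector.\<close>
  define B where "B = mat_of_row c * W + mat_of_row b"
  have c': "mat_of_row c \<in> carrier_mat 1 d" and b': "mat_of_row b \<in> carrier_mat 1 d'"
    using b c by auto
  have B: "B \<in> carrier_mat 1 d'"
    using b' c' W by (simp add: B_def)
  then have "mat_of_row (row B 0) = B"
    by (intro eq_matI) (auto simp: mat_of_row_def)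
  moreover have "Z1 * W + ones_col n * mat_of_row b = Z2 * (Q * W) + ones_col n * B"
  proof -
    have ones_c: "ones_col n * mat_of_row c \<in> carrier_mat n d"
      and ones_cW: "ones_col n * (mat_of_row c * W) \<in> carrier_mat n d'"
      and ones_b: "ones_col n * mat_of_row b \<in> carrier_mat n d'"
      and Z2Q: "Z2 * Q \<in> carrier_mat n d" and Z2QW: "Z2 * (Q * W) \<in> carrier_mat n d'"
      using mult_carrier_mat[OF ones_col_carrier c'] mult_carrier_mat[OF ones_col_carrier b']
        mult_carrier_mat[OF ones_col_carrier mult_carrier_mat[OF c' W]]
        mult_carrier_mat[OF assms(2) Q] mult_carrier_mat[OF assms(2) mult_carrier_mat[OF Q W]]
      by blast+
    have "Z1 * W = Z2 * (Q * W) + ones_col n * (mat_of_row c * W)"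
      using add_mult_distrib_mat[OF Z2Q ones_c W] assoc_mult_mat[OF assms(2) Q W]
        assoc_mult_mat[OF ones_col_carrier c' W]
      by (simp only: Z1)
    moreover have "ones_col n * B = ones_col n * (mat_of_row c * W) + ones_col n * mat_of_row b"
      unfolding B_def
      using mult_add_distrib_mat[OF ones_col_carrier mult_carrier_mat[OF c' W] b'] .
    moreover note assoc_add_mat[OF Z2QW ones_cW ones_b]
    ultimately show ?thesis by simp
  qed
  \<comment> \<open>The first layers agree before \<open>\<sigma>\<close> is applied, so any
    activation gives equal outputs, and the remaining layers are kept unchanged.\<close>
  ultimately have "mlp \<sigma> M Z1 = mlp \<sigma> ((Q * W, row B 0) # ls) Z2"
    using assms(1,2) by (simp add: M mlp_def)
  moreover have "is_mlp d ((Q * W, row B 0) # ls)"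
    using Q W B d' ls by (auto simp: is_mlp_def intro!: exI[of _ d'])
  ultimately show ?thesis by blast
qed

end
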